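(* Let $1\le p\le n$ be integers and let $\mathbf{x}=(x_1,\ldots,x_p)$ be a vector of indeterminates. Let $\Delta^*(n,p,\mathbf{x})=\det_{\boldsymbol{\alpha},\boldsymbol{\beta}\in C^*(n,p)}\left((\mathbf{x}+\boldsymbol{\alpha})^{\boldsymbol{\beta}}\right)$ be the determinant of the square matrix whose rows and columns are indexed by the proper $p$-compositions of $n$ (in the same order) and whose $(\boldsymbol{\alpha},\boldsymbol{\beta})$ entry is $(\mathbf{x}+\boldsymbol{\alpha})^{\boldsymbol{\beta}}$. Then, as polynomials in $x_1,\ldots,x_p$, $$\Delta^*(n,p,\mathbf{x})=(s(\mathbf{x})+n)^{\binom{n-1}{p}}\left(\prod_{i=1}^{n-p+1}\prod_{j=1}^{p}(x_j+i)^{\binom{n-i-1}{p-2}}\right)\prod_{i=1}^{n-p} i^{(p-1)\binom{n-i-1}{p-1}},$$ where $s(\mathbf{x})=x_1+\cdots+x_p$.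
   Context: $C^*(n,p)$ denotes the set of proper $p$-compositions of $n$, i.e. the set of $p$-tuples $\boldsymbol{\alpha}=(\alpha_1,\ldots,\alpha_p)$ of integers with $\alpha_i\ge 1$ for all $i=1,\ldots,p$ and $\alpha_1+\cdots+\alpha_p=n$. For $\boldsymbol{\alpha},\boldsymbol{\beta}\in C^*(n,p)$, $(\mathbf{x}+\boldsymbol{\alpha})^{\boldsymbol{\beta}}=(x_1+\alpha_1)^{\beta_1}\cdots(x_p+\alpha_p)^{\beta_p}$. Empty products equal $1$. Binomial coefficients $\binom{m}{k}$ with $m\ge 0$ are $0$ if $k<0$ or $k>m$; in the degenerate case $p=1$, $i=n$, the exponent $\binom{n-i-1}{p-2}=\binom{-1}{-1}$ is read as $1$. *)

theory Defs
  imports "Jordan_Normal_Form.Determinant" "HOL-Library.Poly_Mapping"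
begin

text \<open>Polynomials over \<open>'a\<close> in indeterminates indexed by \<open>nat\<close>: finitely supported
  functions from monomials (exponent vectors) to coefficients. Indices start at 0, so
  $x_1, \dots, x_p$ are \<open>Var 0, \<dots>, Var (p - 1)\<close>.\<close>

type_synonym 'a mpoly = "(nat \<Rightarrow>\<^sub>0 nat) \<Rightarrow>\<^sub>0 'a"

definition Var :: "nat \<Rightarrow> 'a::comm_ring_1 mpoly" where
  "Var j = Poly_Mapping.single (Poly_Mapping.single j 1) 1"

definition proper_compositions :: "nat \<Rightarrow> nat \<Rightarrow> nat list set" where
  "proper_compositions n p = {\<alpha>. length \<alpha> = p \<and> (\<forall>a\<in>set \<alpha>. a \<ge> 1) \<and> sum_list \<alpha> = n}"

definition shifted_power :: "nat \<Rightarrow> nat list \<Rightarrow> nat list \<Rightarrow> 'a::comm_ring_1 mpoly" where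
  "shifted_power p \<alpha> \<beta> = (\<Prod>j<p. (Var j + of_nat (\<alpha> ! j)) ^ (\<beta> ! j))"

text \<open>The argument \<open>cs\<close> is the common order of rows and columns, to be instantiated with
  a duplicate-free enumeration of \<open>proper_compositions n p\<close>.\<close>

definition compositions_matrix :: "nat \<Rightarrow> nat list list \<Rightarrow> 'a::comm_ring_1 mpoly mat" where
  "compositions_matrix p cs =
     mat (length cs) (length cs) (\<lambda>(r, c). shifted_power p (cs ! r) (cs ! c))"

text \<open>Binomial coefficient with integer arguments, because truncated subtraction would give
  wrong values of ${n-i-1 \choose p-2}$ for $p = 1$: there the coefficient is 0 for $i < n$,
  and for $i = n$ it is ${-1 \choose -1}$, which is read as 1.\<close>

definition ibinom :: "int \<Rightarrow> int \<Rightarrow> nat" where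
  "ibinom m k =
     (if m = -1 \<and> k = -1 then 1
      else if k < 0 \<or> k > m then 0
      else nat m choose nat k)"

end

theory Submission
  imports Defs
begin

text \<open>Write $y_j = x_j + \alpha_j$ for the coordinates of the point belonging to the row $\alpha$,
  number them $0, \dots, q$ with $q = p - 1$, and let $S = s(x) + n$. Each row is divisible by
  $\prod_j y_j$, and dividing by it lowers every exponent by one. The remaining matrix consists of
  the values of all monomials of degree $n - p$ in $p$ variables at the points $x + \alpha$.

  The key observation is that all these points lie on the hyperplane $\sum_j y_j = S$. Thus
  $y_q = S - \sum_{j<q} y_j$, and a unitriangular change of columns replaces each power of $y_q$
  by the same power of the constant \<open>S\<close> (\<open>eliminate_last_coordinate\<close>). The powers of \<open>S\<close> can then be
  taken out of the columns. What is left are the monomials of degree at most $n - p$ in the $q$ free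
  coordinates; they can be exchanged, again unitriangularly, for products of falling factorials in
  the numbers $\alpha_j - 1$ (\<open>powers_to_falling\<close>). On the lattice points $\alpha$ these products
  form a triangular matrix with diagonal entries $\prod_{j<q} (\alpha_j - 1)!$, independent of
  $x$ (\<open>det_falling\<close>). All of this takes place over an arbitrary commutative ring
  (\<open>det_shifted_powers\<close>), which is then specialised to polynomials.

  The determinant is therefore the product of three factors: $\prod_\alpha \prod_j (x_j + \alpha_j)$, a
  power of \<open>S\<close> with exponent $\sum_\alpha (\alpha_q - 1)$, and $\prod_\alpha \prod_{j<q}
  (\alpha_j - 1)!$. All binomial exponents come from counting the proper compositions with a
  part larger than $i$: subtracting $i$ from that part shows that there are ${n-i-1 \choose p-1}$ of
  them (\<open>card_part_greater\<close>).\<close>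

section \<open>Determinants of tables\<close>

text \<open>Indexing rows and columns by the entries of a list, rather than by their positions, makes it
  possible to multiply and compare such determinants by sums over the index set.\<close>
definition det_table :: "'i list \<Rightarrow> ('i \<Rightarrow> 'i \<Rightarrow> 'a::comm_ring_1) \<Rightarrow> 'a" where
  "det_table cs f = det (mat (length cs) (length cs) (\<lambda>(r, c). f (cs ! r) (cs ! c)))"

lemma det_table_cong:
  assumes "\<And>\<alpha> \<beta>. \<alpha> \<in> set cs \<Longrightarrow> \<beta> \<in> set cs \<Longrightarrow> f \<alpha> \<beta> = g \<alpha> \<beta>"
  shows "det_table cs f = det_table cs g"
  unfolding det_table_def
  by (rule arg_cong[where f = det], rule eq_matI) (auto simp: assms)

lemma det_table_mult:
  assumes "distinct cs"
  shows "det_table cs (\<lambda>\<alpha> \<beta>. \<Sum>\<gamma>\<in>set cs. f \<alpha> \<gamma> * g \<gamma> \<beta>) = det_table cs f * det_table cs g"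
proof -
  let ?n = "length cs"
  let ?F = "mat ?n ?n (\<lambda>(r, c). f (cs ! r) (cs ! c))"
  let ?G = "mat ?n ?n (\<lambda>(r, c). g (cs ! r) (cs ! c))"
  have sum_nth: "(\<Sum>\<gamma>\<in>set cs. h \<gamma>) = (\<Sum>i = 0..<?n. h (cs ! i))" for h :: "'a \<Rightarrow> 'b"
    using sum.reindex_bij_betw[OF bij_betw_nth[OF assms refl refl], of h]
    by (simp add: atLeast0LessThan)
  have "mat ?n ?n (\<lambda>(r, c). \<Sum>\<gamma>\<in>set cs. f (cs ! r) \<gamma> * g \<gamma> (cs ! c)) = ?F * ?G"
    by (rule eq_matI) (auto simp: scalar_prod_def sum_nth)
  then show ?thesis
    unfolding det_table_def by (simp add: det_mult[of _ ?n])
qed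

text \<open>Triangularity with respect to a rank \<open>r\<close> that need not separate indices is enough, so
  the list may be in any order. In the Leibniz expansion a nonzero term belongs to a
  permutation along which the rank never decreases and increases strictly wherever an index is
  moved. As a permutation preserves the sum of all ranks, it moves nothing.\<close>
lemma det_table_triangular:
  fixes r :: "'i \<Rightarrow> nat"
  assumes "distinct cs"
    and tri: "\<And>\<alpha> \<beta>. \<alpha> \<in> set cs \<Longrightarrow> \<beta> \<in> set cs \<Longrightarrow> f \<alpha> \<beta> \<noteq> 0 \<Longrightarrow> \<alpha> = \<beta> \<or> r \<alpha> < r \<beta>"
  shows "det_table cs f = (\<Prod>\<alpha>\<in>set cs. f \<alpha> \<alpha>)"
proof -
  let ?n = "length cs"
  let ?A = "mat ?n ?n (\<lambda>(r, c). f (cs ! r) (cs ! c))"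
  let ?t = "\<lambda>\<pi>. signof \<pi> * (\<Prod>i = 0..<?n. ?A $$ (i, \<pi> i))"
  have zero: "?t \<pi> = 0" if \<pi>: "\<pi> permutes {0..<?n}" "\<pi> \<noteq> id" for \<pi>
  proof (rule ccontr)
    assume t: "?t \<pi> \<noteq> 0"
    have entry: "f (cs ! i) (cs ! \<pi> i) \<noteq> 0" if i: "i < ?n" for i
    proof
      assume "f (cs ! i) (cs ! \<pi> i) = 0"
      then have "?A $$ (i, \<pi> i) = 0"
        using i permutes_in_image[OF \<pi>(1), of i] by simp
      then have "(\<Prod>i = 0..<?n. ?A $$ (i, \<pi> i)) = 0"
        using i by (intro prod_zero) auto
      then show False using t by simp
    qed
    have \<pi>_less: "\<pi> i < ?n" if "i < ?n" for i
      using that permutes_in_image[OF \<pi>(1), of i] by simp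
    have step: "i = \<pi> i \<or> r (cs ! i) < r (cs ! \<pi> i)" if i: "i < ?n" for i
      using tri[OF nth_mem[OF i] nth_mem[OF \<pi>_less[OF i]] entry[OF i]] i \<pi>_less[OF i] assms(1)
      by (simp add: nth_eq_iff_index_eq)
    obtain k where k: "\<pi> k \<noteq> k" using \<pi>(2) by (auto simp: fun_eq_iff)
    then have "k < ?n" using permutes_not_in[OF \<pi>(1), of k] by auto
    then have "(\<Sum>i = 0..<?n. r (cs ! i)) < (\<Sum>i = 0..<?n. r (cs ! \<pi> i))"
    proof (intro sum_strict_mono_ex1 ballI)
      show "r (cs ! i) \<le> r (cs ! \<pi> i)" if "i \<in> {0..<?n}" for i
        using step[of i] that by auto
      show "\<exists>i\<in>{0..<?n}. r (cs ! i) < r (cs ! \<pi> i)"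
        using step[OF \<open>k < ?n\<close>] k \<open>k < ?n\<close> by (intro bexI[of _ k]) auto
    qed simp
    moreover have "(\<Sum>i = 0..<?n. r (cs ! \<pi> i)) = (\<Sum>i = 0..<?n. r (cs ! i))"
      using sum.permute[OF \<pi>(1), of "\<lambda>i. r (cs ! i)"] by (simp add: o_def)
    ultimately show False by simp
  qed
  have "det_table cs f = (\<Sum>\<pi>\<in>{\<pi>. \<pi> permutes {0..<?n}}. ?t \<pi>)"
    unfolding det_table_def by (rule det_def'[of _ ?n]) simp
  also have "\<dots> = (\<Sum>\<pi>\<in>{id}. ?t \<pi>)"
    using zero by (intro sum.mono_neutral_right) (auto simp: permutes_id finite_permutations)
  also have "\<dots> = (\<Prod>i = 0..<?n. f (cs ! i) (cs ! i))"
    by simp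
  also have "\<dots> = (\<Prod>\<alpha>\<in>set cs. f \<alpha> \<alpha>)"
    using prod.reindex_bij_betw[OF bij_betw_nth[OF assms(1) refl refl], of "\<lambda>\<alpha>. f \<alpha> \<alpha>"]
    by (simp add: atLeast0LessThan)
  finally show ?thesis .
qed

lemma det_table_diagonal:
  assumes "distinct cs"
  shows "det_table cs (\<lambda>\<alpha> \<beta>. if \<alpha> = \<beta> then u \<alpha> else 0) = (\<Prod>\<alpha>\<in>set cs. u \<alpha>)"
  by (subst det_table_triangular[OF assms, where r = "\<lambda>_. 0"]) (auto split: if_splits)

lemma det_table_scale_rows:
  assumes "distinct cs"
  shows "det_table cs (\<lambda>\<alpha> \<beta>. u \<alpha> * f \<alpha> \<beta>) = (\<Prod>\<alpha>\<in>set cs. u \<alpha>) * det_table cs f"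
proof -
  have "det_table cs (\<lambda>\<alpha> \<beta>. u \<alpha> * f \<alpha> \<beta>)
      = det_table cs (\<lambda>\<alpha> \<beta>. \<Sum>\<gamma>\<in>set cs. (if \<alpha> = \<gamma> then u \<alpha> else 0) * f \<gamma> \<beta>)"
    by (rule det_table_cong) (simp add: if_distrib[of "\<lambda>x. x * _"] cong: if_cong)
  then show ?thesis
    by (simp add: det_table_mult[OF assms] det_table_diagonal[OF assms])
qed

lemma det_table_scale_columns:
  assumes "distinct cs"
  shows "det_table cs (\<lambda>\<alpha> \<beta>. f \<alpha> \<beta> * v \<beta>) = det_table cs f * (\<Prod>\<beta>\<in>set cs. v \<beta>)"
proof -
  have "det_table cs (\<lambda>\<alpha> \<beta>. f \<alpha> \<beta> * v \<beta>)
      = det_table cs (\<lambda>\<alpha> \<beta>. \<Sum>\<gamma>\<in>set cs. f \<alpha> \<gamma> * (if \<gamma> = \<beta> then v \<gamma> else 0))"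
    by (rule det_table_cong) (simp add: if_distrib[of "\<lambda>x. _ * x"] cong: if_cong)
  then show ?thesis
    by (simp add: det_table_mult[OF assms] det_table_diagonal[OF assms])
qed

section \<open>Unitriangular changes of columns\<close>

text \<open>The functions on \<open>C\<close> that are linear combinations of those columns of the table \<open>g\<close> whose
  index has rank below \<open>k\<close>. Values outside \<open>C\<close> are unconstrained, because the relations between
  columns used below hold only for actual compositions.\<close>
definition lower_span ::
  "'i set \<Rightarrow> ('i \<Rightarrow> nat) \<Rightarrow> ('i \<Rightarrow> 'i \<Rightarrow> 'a::comm_ring_1) \<Rightarrow> nat \<Rightarrow> ('i \<Rightarrow> 'a) set" where
  "lower_span C r g k =
     {h. \<exists>c. \<forall>\<alpha>\<in>C. h \<alpha> = (\<Sum>\<gamma>\<in>{\<gamma>\<in>C. r \<gamma> < k}. g \<alpha> \<gamma> * c \<gamma>)}"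

lemma lower_span_zero: "(\<lambda>_. 0) \<in> lower_span C r g k"
  unfolding lower_span_def by (auto intro!: exI[of _ "\<lambda>_. 0"])

lemma lower_span_add:
  assumes "h \<in> lower_span C r g k" "h' \<in> lower_span C r g k"
  shows "(\<lambda>\<alpha>. h \<alpha> + h' \<alpha>) \<in> lower_span C r g k"
proof -
  obtain c c' where
    "\<forall>\<alpha>\<in>C. h \<alpha> = (\<Sum>\<gamma>\<in>{\<gamma>\<in>C. r \<gamma> < k}. g \<alpha> \<gamma> * c \<gamma>)"
    "\<forall>\<alpha>\<in>C. h' \<alpha> = (\<Sum>\<gamma>\<in>{\<gamma>\<in>C. r \<gamma> < k}. g \<alpha> \<gamma> * c' \<gamma>)"
    using assms unfolding lower_span_def by blast
  then show ?thesis
    unfolding lower_span_def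
    by (auto intro!: exI[of _ "\<lambda>\<gamma>. c \<gamma> + c' \<gamma>"] simp: distrib_left sum.distrib)
qed

lemma lower_span_scale:
  assumes "h \<in> lower_span C r g k"
  shows "(\<lambda>\<alpha>. s * h \<alpha>) \<in> lower_span C r g k"
proof -
  obtain c where "\<forall>\<alpha>\<in>C. h \<alpha> = (\<Sum>\<gamma>\<in>{\<gamma>\<in>C. r \<gamma> < k}. g \<alpha> \<gamma> * c \<gamma>)"
    using assms unfolding lower_span_def by blast
  then show ?thesis
    unfolding lower_span_def
    by (auto intro!: exI[of _ "\<lambda>\<gamma>. s * c \<gamma>"] simp: sum_distrib_left mult_ac)
qed

lemma lower_span_diff:
  assumes "h \<in> lower_span C r g k" "h' \<in> lower_span C r g k"
  shows "(\<lambda>\<alpha>. h \<alpha> - h' \<alpha>) \<in> lower_span C r g k"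
  using lower_span_add[OF assms(1) lower_span_scale[OF assms(2), of "-1"]] by simp

lemma lower_span_sum:
  assumes "\<And>j. j \<in> J \<Longrightarrow> h j \<in> lower_span C r g k"
  shows "(\<lambda>\<alpha>. \<Sum>j\<in>J. h j \<alpha>) \<in> lower_span C r g k"
  using assms
  by (induction J rule: infinite_finite_induct) (auto simp: lower_span_zero lower_span_add)

lemma lower_span_mono:
  assumes "finite C" "h \<in> lower_span C r g k" "k \<le> l"
  shows "h \<in> lower_span C r g l"
proof -
  obtain c where c: "\<forall>\<alpha>\<in>C. h \<alpha> = (\<Sum>\<gamma>\<in>{\<gamma>\<in>C. r \<gamma> < k}. g \<alpha> \<gamma> * c \<gamma>)"
    using assms(2) unfolding lower_span_def by blast
  have "(\<Sum>\<gamma>\<in>{\<gamma>\<in>C. r \<gamma> < k}. g \<alpha> \<gamma> * c \<gamma>)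
      = (\<Sum>\<gamma>\<in>{\<gamma>\<in>C. r \<gamma> < l}. g \<alpha> \<gamma> * (if r \<gamma> < k then c \<gamma> else 0))" for \<alpha>
    using assms(1,3) by (intro sum.mono_neutral_cong_left) auto
  with c show ?thesis
    unfolding lower_span_def by (auto intro!: exI[of _ "\<lambda>\<gamma>. if r \<gamma> < k then c \<gamma> else 0"])
qed

lemma lower_span_base:
  assumes "finite C" "\<beta> \<in> C" "r \<beta> < k"
  shows "(\<lambda>\<alpha>. g \<alpha> \<beta>) \<in> lower_span C r g k"
  unfolding lower_span_def using assms
  by (auto intro!: exI[of _ "\<lambda>\<gamma>. if \<gamma> = \<beta> then 1 else 0"]
    simp: if_distrib[of "\<lambda>x. _ * x"] cong: if_cong)

lemma lower_span_cong:
  assumes "h \<in> lower_span C r g k" "\<And>\<alpha>. \<alpha> \<in> C \<Longrightarrow> h' \<alpha> = h \<alpha>"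
  shows "h' \<in> lower_span C r g k"
  using assms unfolding lower_span_def by auto

text \<open>The two tables differ by a factor that is unitriangular with respect to \<open>r\<close>. Membership in
  the span suffices, so the entries of that factor never have to be computed.\<close>
lemma det_table_unitriangular_change:
  assumes "distinct cs"
    and span: "\<And>\<beta>. \<beta> \<in> set cs \<Longrightarrow>
      (\<lambda>\<alpha>. f \<alpha> \<beta> - g \<alpha> \<beta>) \<in> lower_span (set cs) r g (r \<beta>)"
  shows "det_table cs f = det_table cs g"
proof -
  have "\<forall>\<beta>. \<exists>c. \<beta> \<in> set cs \<longrightarrow> (\<forall>\<alpha>\<in>set cs.
      f \<alpha> \<beta> - g \<alpha> \<beta> = (\<Sum>\<gamma>\<in>{\<gamma>\<in>set cs. r \<gamma> < r \<beta>}. g \<alpha> \<gamma> * c \<gamma>))"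
    using span unfolding lower_span_def by blast
  then obtain c where c: "\<And>\<alpha> \<beta>. \<alpha> \<in> set cs \<Longrightarrow> \<beta> \<in> set cs \<Longrightarrow>
      f \<alpha> \<beta> - g \<alpha> \<beta> = (\<Sum>\<gamma>\<in>{\<gamma>\<in>set cs. r \<gamma> < r \<beta>}. g \<alpha> \<gamma> * c \<beta> \<gamma>)"
    by metis
  define U where "U \<gamma> \<beta> = (if \<gamma> = \<beta> then 1 else if r \<gamma> < r \<beta> then c \<beta> \<gamma> else 0)" for \<gamma> \<beta>
  have "f \<alpha> \<beta> = (\<Sum>\<gamma>\<in>set cs. g \<alpha> \<gamma> * U \<gamma> \<beta>)" if \<alpha>: "\<alpha> \<in> set cs" and \<beta>: "\<beta> \<in> set cs" for \<alpha> \<beta>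
  proof -
    have "(\<Sum>\<gamma>\<in>set cs. g \<alpha> \<gamma> * U \<gamma> \<beta>)
        = (\<Sum>\<gamma>\<in>set cs. (if \<gamma> = \<beta> then g \<alpha> \<beta> else 0) +
            (if r \<gamma> < r \<beta> then g \<alpha> \<gamma> * c \<beta> \<gamma> else 0))"
      by (intro sum.cong) (auto simp: U_def)
    also have "\<dots> = g \<alpha> \<beta> + (\<Sum>\<gamma>\<in>{\<gamma>\<in>set cs. r \<gamma> < r \<beta>}. g \<alpha> \<gamma> * c \<beta> \<gamma>)"
      using \<beta> by (simp add: sum.distrib sum.inter_filter)
    finally show ?thesis using c[OF \<alpha> \<beta>] by (simp add: algebra_simps)
  qed
  then have "det_table cs f = det_table cs (\<lambda>\<alpha> \<beta>. \<Sum>\<gamma>\<in>set cs. g \<alpha> \<gamma> * U \<gamma> \<beta>)"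
    by (intro det_table_cong) auto
  also have "\<dots> = det_table cs g * det_table cs U"
    by (rule det_table_mult[OF assms(1)])
  also have "det_table cs U = (\<Prod>\<alpha>\<in>set cs. U \<alpha> \<alpha>)"
    by (rule det_table_triangular[OF assms(1), of _ r]) (auto simp: U_def split: if_splits)
  also have "\<dots> = 1" by (simp add: U_def)
  finally show ?thesis by simp
qed

section \<open>Counting proper compositions by the size of a part\<close>

lemma finite_proper_compositions: "finite (proper_compositions n p)"
proof (rule finite_subset)
  show "proper_compositions n p \<subseteq> {xs. set xs \<subseteq> {..n} \<and> length xs = p}"
    by (auto simp: proper_compositions_def member_le_sum_list)
  show "finite {xs. set xs \<subseteq> {..n} \<and> length xs = p}"
    by (rule finite_lists_length_eq) simp
qed

text \<open>Subtracting 1 from every part gives the weak compositions of \<open>n - p\<close>. The integer binomial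
  coefficient also covers \<open>n < p\<close>, where both sides vanish.\<close>
lemma card_proper_compositions:
  assumes "1 \<le> p"
  shows "card (proper_compositions n p) = ibinom (int n - 1) (int p - 1)"
proof (cases "p \<le> n")
  case True
  have "bij_betw (map Suc) {l. size l = p \<and> sum_list l = n - p} (proper_compositions n p)"
  proof (rule bij_betw_byWitness[where f' = "map (\<lambda>a. a - 1)"])
    show "map Suc ` {l. size l = p \<and> sum_list l = n - p} \<subseteq> proper_compositions n p"
      using True by (auto simp: proper_compositions_def sum_list_Suc)
    have "sum_list (map (\<lambda>a. a - 1) xs) = sum_list xs - length xs"
      if "\<forall>a\<in>set xs. a \<ge> 1" for xs :: "nat list"
    proof -
      have "sum_list (map (\<lambda>a. a - 1) xs) + length xs = sum_list xs"
        using that by (induction xs) auto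
      then show ?thesis by simp
    qed
    then show "map (\<lambda>a. a - 1) ` proper_compositions n p \<subseteq> {l. size l = p \<and> sum_list l = n - p}"
      by (auto simp: proper_compositions_def)
  qed (auto simp: proper_compositions_def intro!: map_idI)
  then have "card (proper_compositions n p) = (n - p + p - 1) choose (n - p)"
    by (metis bij_betw_same_card card_length_sum_list)
  also have "\<dots> = (n - 1) choose (p - 1)"
    using assms True binomial_symmetric[of "p - 1" "n - 1"] by simp
  also have "\<dots> = ibinom (int n - 1) (int p - 1)"
    using assms True by (auto simp: ibinom_def nat_diff_distrib)
  finally show ?thesis .
next
  case False
  have "length xs \<le> sum_list xs" if "\<forall>a\<in>set xs. a \<ge> 1" for xs :: "nat list"
    using that by (induction xs) auto
  then have "proper_compositions n p = {}"
    using False by (fastforce simp: proper_compositions_def)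
  then show ?thesis using False assms by (simp add: ibinom_def)
qed

lemma proper_compositions_update_iff:
  assumes "j < length \<alpha>" "\<alpha> \<in> proper_compositions n p"
  shows "\<alpha>[j := a] \<in> proper_compositions (n + a - \<alpha> ! j) p \<longleftrightarrow> 1 \<le> a"
  using assms set_update_subset_insert[of \<alpha> j a] set_update_memI[of j \<alpha> a]
  by (auto simp: proper_compositions_def sum_list_update)

lemma part_le: "\<alpha> \<in> proper_compositions n p \<Longrightarrow> j < p \<Longrightarrow> \<alpha> ! j \<le> n"
  using elem_le_sum_list[of j \<alpha>] by (auto simp: proper_compositions_def)

text \<open>Subtracting \<open>i\<close> from the part in question leaves an arbitrary proper composition of \<open>n - i\<close>.\<close>
lemma card_part_greater:
  assumes "j < p"
  shows "card {\<alpha> \<in> proper_compositions n p. i < \<alpha> ! j} = ibinom (int n - int i - 1) (int p - 1)"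
proof -
  have "bij_betw (\<lambda>\<alpha>. \<alpha>[j := \<alpha> ! j - i])
      {\<alpha> \<in> proper_compositions n p. i < \<alpha> ! j} (proper_compositions (n - i) p)"
  proof (rule bij_betw_byWitness[where f' = "\<lambda>\<alpha>. \<alpha>[j := \<alpha> ! j + i]"])
    show "(\<lambda>\<alpha>. \<alpha>[j := \<alpha> ! j - i]) ` {\<alpha> \<in> proper_compositions n p. i < \<alpha> ! j}
        \<subseteq> proper_compositions (n - i) p"
    proof clarify
      fix \<alpha> assume \<alpha>: "\<alpha> \<in> proper_compositions n p" "i < \<alpha> ! j"
      then have "\<alpha> ! j \<le> n" "j < length \<alpha>"
        using part_le[of \<alpha> n p j] assms by (auto simp: proper_compositions_def)
      with \<alpha> show "\<alpha>[j := \<alpha> ! j - i] \<in> proper_compositions (n - i) p"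
        using proper_compositions_update_iff[of j \<alpha> n p "\<alpha> ! j - i"] by simp
    qed
    show "(\<lambda>\<alpha>. \<alpha>[j := \<alpha> ! j + i]) ` proper_compositions (n - i) p
        \<subseteq> {\<alpha> \<in> proper_compositions n p. i < \<alpha> ! j}"
    proof clarify
      fix \<alpha> assume \<alpha>: "\<alpha> \<in> proper_compositions (n - i) p"
      then have j: "j < length \<alpha>" "1 \<le> \<alpha> ! j" "\<alpha> ! j \<le> n - i"
        using part_le[of \<alpha> "n - i" p j] assms by (auto simp: proper_compositions_def)
      with \<alpha> show "\<alpha>[j := \<alpha> ! j + i] \<in> proper_compositions n p
          \<and> i < \<alpha>[j := \<alpha> ! j + i] ! j"
        using proper_compositions_update_iff[of j \<alpha> "n - i" p "\<alpha> ! j + i"] by simp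
    qed
  qed (use assms in \<open>auto simp: proper_compositions_def\<close>)
  then have "card {\<alpha> \<in> proper_compositions n p. i < \<alpha> ! j} = ibinom (int (n - i) - 1) (int p - 1)"
    using assms by (simp add: bij_betw_same_card card_proper_compositions)
  also have "\<dots> = ibinom (int n - int i - 1) (int p - 1)"
    using assms by (cases "i \<le> n") (auto simp: ibinom_def of_nat_diff)
  finally show ?thesis .
qed

text \<open>A part equals \<open>i\<close> if it exceeds \<open>i - 1\<close> but not \<open>i\<close>, so this is Pascal's rule. For \<open>p = 1\<close>
  only \<open>i = n\<close> contributes, which is where the reading ${-1 \choose -1} = 1$ is needed.\<close>
lemma card_part_eq:
  assumes "j < p" "1 \<le> i" "i \<le> n - p + 1" "p \<le> n"
  shows "card {\<alpha> \<in> proper_compositions n p. \<alpha> ! j = i} = ibinom (int n - int i - 1) (int p - 2)"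
proof -
  let ?C = "proper_compositions n p"
  have "{\<alpha> \<in> ?C. i - 1 < \<alpha> ! j} = {\<alpha> \<in> ?C. \<alpha> ! j = i} \<union> {\<alpha> \<in> ?C. i < \<alpha> ! j}"
    using assms(2) by auto
  then have "card {\<alpha> \<in> ?C. i - 1 < \<alpha> ! j}
      = card {\<alpha> \<in> ?C. \<alpha> ! j = i} + card {\<alpha> \<in> ?C. i < \<alpha> ! j}"
    using finite_proper_compositions[of n p] by (simp add: card_Un_disjoint disjoint_iff)
  then have "card {\<alpha> \<in> ?C. \<alpha> ! j = i} + ibinom (int n - int i - 1) (int p - 1)
      = ibinom (int n - int i) (int p - 1)"
    using assms by (simp add: card_part_greater of_nat_diff)
  also have "\<dots> = ibinom (int n - int i - 1) (int p - 2) + ibinom (int n - int i - 1) (int p - 1)"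
  proof (cases "p = 1")
    case True
    then show ?thesis using assms by (auto simp: ibinom_def)
  next
    case False
    define k m where "k = p - 2" and "m = n - i - 1"
    have p: "p = Suc (Suc k)" and n: "n = i + Suc m"
      using False assms by (auto simp: k_def m_def)
    with assms have "k \<le> m" by simp
    then show ?thesis by (auto simp: p n ibinom_def nat_add_distrib)
  qed
  finally show ?thesis by simp
qed

text \<open>A part \<open>a\<close> exceeds exactly \<open>a - 1\<close> positive integers. Exchanging the two sums
  turns the left-hand side into the numbers of \<open>card_part_greater\<close> added up over \<open>i\<close>, a column of Pascal's triangle.\<close>
lemma sum_part_minus_one:
  assumes "j < p" "p \<le> n"
  shows "(\<Sum>\<alpha>\<in>proper_compositions n p. \<alpha> ! j - 1) = ibinom (int n - 1) (int p)"
proof -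
  let ?C = "proper_compositions n p"
  have "(\<Sum>\<alpha>\<in>?C. \<alpha> ! j - 1) = (\<Sum>\<alpha>\<in>?C. \<Sum>i = 1..n - 1. if i < \<alpha> ! j then 1 else 0)"
  proof (rule sum.cong)
    fix \<alpha> assume "\<alpha> \<in> ?C"
    then have "{i. 1 \<le> i \<and> i \<le> n - 1 \<and> i < \<alpha> ! j} = {1..<\<alpha> ! j}"
      using part_le[of \<alpha> n p j] assms by auto
    then show "\<alpha> ! j - 1 = (\<Sum>i = 1..n - 1. if i < \<alpha> ! j then 1 else 0)"
      by (simp add: sum.If_cases Collect_conj_eq[symmetric] Int_def)
  qed simp
  also have "\<dots> = (\<Sum>i = 1..n - 1. card {\<alpha> \<in> ?C. i < \<alpha> ! j})"
    by (subst sum.swap) (simp add: sum.If_cases finite_proper_compositions Int_def)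
  also have "\<dots> = (\<Sum>i = 1..n - 1. (n - i - 1) choose (p - 1))"
    using assms by (intro sum.cong) (auto simp: card_part_greater ibinom_def nat_diff_distrib)
  also have "\<dots> = (\<Sum>k<n - 1. k choose (p - 1))"
    by (rule sum.reindex_bij_witness[where i = "\<lambda>k. n - 1 - k" and j = "\<lambda>i. n - 1 - i"]) auto
  also have "\<dots> = (n - 1) choose p"
    using assms by (cases "n - 1") (auto simp: lessThan_Suc_atMost sum_choose_upper)
  also have "\<dots> = ibinom (int n - 1) (int p)"
    using assms by (auto simp: ibinom_def nat_diff_distrib)
  finally show ?thesis .
qed

lemma prod_by_part:
  fixes u :: "nat \<Rightarrow> 'a::comm_monoid_mult"
  assumes "j < p" "p \<le> n"
  shows "(\<Prod>\<alpha>\<in>proper_compositions n p. u (\<alpha> ! j))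
    = (\<Prod>i = 1..n - p + 1. u i ^ ibinom (int n - int i - 1) (int p - 2))"
proof -
  let ?C = "proper_compositions n p"
  have range: "\<alpha> ! j \<in> {1..n - p + 1}" if \<alpha>: "\<alpha> \<in> ?C" for \<alpha>
  proof -
    have "1 \<le> \<alpha> ! j" using \<alpha> assms by (auto simp: proper_compositions_def)
    moreover have "\<not> n - p + 1 < \<alpha> ! j"
    proof
      assume "n - p + 1 < \<alpha> ! j"
      then have "card {\<alpha> \<in> ?C. n - p + 1 < \<alpha> ! j} \<noteq> 0"
        using \<alpha> finite_proper_compositions[of n p] by auto
      then show False using assms by (simp add: card_part_greater ibinom_def of_nat_diff split: if_splits)
    qed
    ultimately show ?thesis by simp
  qed
  have "(\<Prod>\<alpha>\<in>?C. u (\<alpha> ! j)) = (\<Prod>i = 1..n - p + 1. \<Prod>\<alpha>\<in>{\<alpha> \<in> ?C. \<alpha> ! j = i}. u (\<alpha> ! j))"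
    using range by (intro prod.group[symmetric]) (auto simp: finite_proper_compositions)
  also have "\<dots> = (\<Prod>i = 1..n - p + 1. u i ^ card {\<alpha> \<in> ?C. \<alpha> ! j = i})"
    by (intro prod.cong) auto
  finally show ?thesis using assms by (simp add: card_part_eq)
qed

text \<open>In $(a-1)! = \prod_{i<a} i$ the factor \<open>i\<close> occurs once for each composition whose part
  exceeds \<open>i\<close>.\<close>
lemma prod_fact_part:
  assumes "j < p" "p \<le> n"
  shows "(\<Prod>\<alpha>\<in>proper_compositions n p. fact (\<alpha> ! j - 1) :: nat)
    = (\<Prod>i = 1..n - p. i ^ ibinom (int n - int i - 1) (int p - 1))"
proof -
  let ?C = "proper_compositions n p"
  have "(\<Prod>\<alpha>\<in>?C. fact (\<alpha> ! j - 1) :: nat) = (\<Prod>\<alpha>\<in>?C. \<Prod>i = 1..n. if i < \<alpha> ! j then i else 1)"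
  proof (rule prod.cong)
    fix \<alpha> assume "\<alpha> \<in> ?C"
    then have "{i. 1 \<le> i \<and> i \<le> n \<and> i < \<alpha> ! j} = {1..\<alpha> ! j - 1}"
      using part_le[of \<alpha> n p j] assms by auto
    then show "fact (\<alpha> ! j - 1) = (\<Prod>i = 1..n. if i < \<alpha> ! j then i else 1)"
      by (simp add: fact_prod prod.If_cases Int_def)
  qed simp
  also have "\<dots> = (\<Prod>i = 1..n. i ^ card {\<alpha> \<in> ?C. i < \<alpha> ! j})"
    by (subst prod.swap) (simp add: prod.If_cases finite_proper_compositions Int_def)
  also have "\<dots> = (\<Prod>i = 1..n. i ^ ibinom (int n - int i - 1) (int p - 1))"
    using assms by (simp add: card_part_greater)
  also have "\<dots> = (\<Prod>i = 1..n - p. i ^ ibinom (int n - int i - 1) (int p - 1))"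
    using assms by (intro prod.mono_neutral_right) (auto simp: ibinom_def)
  finally show ?thesis .
qed

section \<open>Falling factorials\<close>

definition falling :: "nat \<Rightarrow> nat \<Rightarrow> 'a::comm_ring_1" where
  "falling a k = (\<Prod>i<k. of_nat a - of_nat i)"

lemma falling_0: "falling a 0 = 1"
  by (simp add: falling_def)

lemma falling_Suc: "falling a (Suc k) = falling a k * (of_nat a - of_nat k)"
  by (simp add: falling_def)

lemma falling_eq_0: "a < k \<Longrightarrow> falling a k = 0"
  unfolding falling_def by (rule prod_zero) auto

lemma falling_self: "falling a a = (of_nat (fact a) :: 'a::comm_ring_1)"
proof -
  have "falling a a = (\<Prod>i = 0..<a. of_nat (a - i) :: 'a)"
    unfolding falling_def by (intro prod.cong) (auto simp: of_nat_diff)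
  also have "\<dots> = of_nat (fact a)"
    by (simp add: fact_prod_rev)
  finally show ?thesis .
qed

section \<open>Reduction to a triangular matrix\<close>

lemma sum_nth_composition:
  assumes "\<alpha> \<in> proper_compositions n p"
  shows "(\<Sum>j<p. \<alpha> ! j) = n"
  using assms by (auto simp: proper_compositions_def sum_list_sum_nth atLeast0LessThan)

text \<open>The exponent vectors produced by both reduction steps below arise in this way.\<close>
lemma move_unit:
  assumes "\<gamma> \<in> proper_compositions n p" "i < p" "j < p" "i \<noteq> j" "2 \<le> \<gamma> ! i"
  shows "\<gamma>[i := \<gamma> ! i - 1, j := \<gamma> ! j + 1] \<in> proper_compositions n p"
proof -
  have \<gamma>: "length \<gamma> = p" "\<forall>a\<in>set \<gamma>. 1 \<le> a" "sum_list \<gamma> = n"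
    using assms(1) by (auto simp: proper_compositions_def)
  let ?\<gamma> = "\<gamma>[i := \<gamma> ! i - 1]"
  have le: "\<gamma> ! i \<le> n" using part_le assms by blast
  have 1: "?\<gamma> \<in> proper_compositions (n - 1) p"
    using proper_compositions_update_iff[of i \<gamma> n p "\<gamma> ! i - 1"] assms \<gamma> le by simp
  have "?\<gamma>[j := \<gamma> ! j + 1] \<in> proper_compositions (n - 1 + (\<gamma> ! j + 1) - ?\<gamma> ! j) p"
    using proper_compositions_update_iff[OF _ 1, of j "\<gamma> ! j + 1"] assms \<gamma> by simp
  then show ?thesis using assms le by simp
qed

text \<open>On the points $x + \alpha$ the coordinate sum has the constant value \<open>S\<close>. Hence one factor
  $y_q$ can be replaced by $S - \sum_{j<q} y_j$: the first summand raises the exponent of \<open>S\<close>,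
  and each of the others moves a unit from the exponent of the last coordinate to that of
  another one. The lemma treats a mixed column, in which $y_q$ carries \<open>b\<close> of the units of the last
  exponent and \<open>S\<close> the remaining ones, so that the replacement is an induction on \<open>b\<close>. The rank
  is the last part of the exponent vector.\<close>
lemma eliminate_last_coordinate:
  fixes x :: "nat \<Rightarrow> 'a::comm_ring_1" and n q :: nat
  defines "C \<equiv> proper_compositions n (Suc q)"
    and "y \<equiv> \<lambda>\<alpha> j. x j + of_nat (\<alpha> ! j)"
    and "S \<equiv> (\<Sum>j<Suc q. x j) + of_nat n"
  defines "g \<equiv> \<lambda>\<alpha> \<gamma>. (\<Prod>j<q. y \<alpha> j ^ (\<gamma> ! j - 1)) * S ^ (\<gamma> ! q - 1)"
  assumes "\<gamma> \<in> C" "b \<le> \<gamma> ! q - 1"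
  shows "(\<lambda>\<alpha>. (\<Prod>j<q. y \<alpha> j ^ (\<gamma> ! j - 1)) * S ^ (\<gamma> ! q - 1 - b) * y \<alpha> q ^ b - g \<alpha> \<gamma>)
    \<in> lower_span C (\<lambda>\<gamma>. \<gamma> ! q) g (\<gamma> ! q)"
  using assms(5,6)
proof (induction b arbitrary: \<gamma>)
  case 0
  show ?case by (simp add: g_def lower_span_zero)
next
  case (Suc b)
  have fin: "finite C" by (simp add: C_def finite_proper_compositions)
  have len: "length \<gamma> = Suc q" using Suc.prems by (simp add: C_def proper_compositions_def)
  define a where "a = \<gamma> ! q - 1 - Suc b"
  have a: "\<gamma> ! q - 1 - b = Suc a" "\<gamma> ! q = Suc (Suc (a + b))"
    using Suc.prems by (auto simp: a_def)
  define \<gamma>' where "\<gamma>' j = \<gamma>[q := \<gamma> ! q - 1, j := \<gamma> ! j + 1]" for j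
  have \<gamma>': "\<gamma>' j \<in> C" "\<gamma>' j ! q = Suc (a + b)" if "j < q" for j
    using Suc.prems move_unit[of \<gamma> n "Suc q" q j] that len a by (auto simp: \<gamma>'_def C_def)
  have prod_\<gamma>': "(\<Prod>i<q. y \<alpha> i ^ (\<gamma>' j ! i - 1)) = (\<Prod>i<q. y \<alpha> i ^ (\<gamma> ! i - 1)) * y \<alpha> j"
    if j: "j < q" for j \<alpha>
  proof -
    have "\<gamma> ! j \<in> set \<gamma>" using j len by simp
    then have "1 \<le> \<gamma> ! j" using Suc.prems by (auto simp: C_def proper_compositions_def)
    then have "y \<alpha> j ^ (\<gamma> ! j) = y \<alpha> j ^ (\<gamma> ! j - 1) * y \<alpha> j"
      by (cases "\<gamma> ! j") auto
    moreover have "(\<Prod>i\<in>{..<q} - {j}. y \<alpha> i ^ (\<gamma>' j ! i - 1))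
        = (\<Prod>i\<in>{..<q} - {j}. y \<alpha> i ^ (\<gamma> ! i - 1))"
      by (intro prod.cong) (auto simp: \<gamma>'_def)
    moreover have "\<gamma>' j ! j - 1 = \<gamma> ! j" using j len by (simp add: \<gamma>'_def)
    ultimately show ?thesis
      using j by (simp add: prod.remove[of "{..<q}" j] mult_ac)
  qed
  let ?h = "\<lambda>\<gamma> b \<alpha>. (\<Prod>j<q. y \<alpha> j ^ (\<gamma> ! j - 1)) * S ^ (\<gamma> ! q - 1 - b) * y \<alpha> q ^ b"
  let ?L = "lower_span C (\<lambda>\<gamma>. \<gamma> ! q) g (\<gamma> ! q)"
  \<comment> \<open>The summand with \<open>S\<close> is the column of \<open>\<gamma>\<close> itself; those with $y_j$ have lower rank.\<close>
  have "(\<lambda>\<alpha>. ?h \<gamma> b \<alpha> - g \<alpha> \<gamma>) \<in> ?L"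
    using Suc by simp
  moreover have "(\<lambda>\<alpha>. \<Sum>j<q. (?h (\<gamma>' j) b \<alpha> - g \<alpha> (\<gamma>' j)) + g \<alpha> (\<gamma>' j)) \<in> ?L"
  proof (rule lower_span_sum, rule lower_span_add)
    fix j assume "j \<in> {..<q}"
    then have j: "\<gamma>' j \<in> C" "\<gamma>' j ! q = Suc (a + b)" using \<gamma>' by auto
    show "(\<lambda>\<alpha>. ?h (\<gamma>' j) b \<alpha> - g \<alpha> (\<gamma>' j)) \<in> ?L"
      by (rule lower_span_mono[OF fin Suc.IH]) (use j a in auto)
    show "(\<lambda>\<alpha>. g \<alpha> (\<gamma>' j)) \<in> ?L"
      by (rule lower_span_base) (use fin j a in auto)
  qed
  ultimately have "(\<lambda>\<alpha>. (?h \<gamma> b \<alpha> - g \<alpha> \<gamma>)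
      - (\<Sum>j<q. (?h (\<gamma>' j) b \<alpha> - g \<alpha> (\<gamma>' j)) + g \<alpha> (\<gamma>' j))) \<in> ?L"
    by (rule lower_span_diff)
  then show ?case
  proof (rule lower_span_cong)
    fix \<alpha> assume "\<alpha> \<in> C"
    then have "(\<Sum>j<Suc q. y \<alpha> j) = S"
      using sum_nth_composition[of \<alpha> n "Suc q"]
      by (simp only: y_def S_def C_def sum.distrib of_nat_sum[symmetric])
    then have yq: "y \<alpha> q = S - (\<Sum>j<q. y \<alpha> j)" by (simp add: algebra_simps)
    let ?P = "\<Prod>j<q. y \<alpha> j ^ (\<gamma> ! j - 1)"
    have "?h \<gamma> (Suc b) \<alpha> = ?P * S ^ a * y \<alpha> q ^ b * y \<alpha> q"
      by (simp add: a_def mult_ac)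
    also have "\<dots> = ?P * S ^ a * y \<alpha> q ^ b * S - ?P * S ^ a * y \<alpha> q ^ b * (\<Sum>j<q. y \<alpha> j)"
      by (subst (2) yq) (simp add: right_diff_distrib)
    also have "?P * S ^ a * y \<alpha> q ^ b * S = ?h \<gamma> b \<alpha>"
      by (simp only: a(1)) (simp add: mult_ac)
    also have "?P * S ^ a * y \<alpha> q ^ b * (\<Sum>j<q. y \<alpha> j) = (\<Sum>j<q. ?h (\<gamma>' j) b \<alpha>)"
      unfolding sum_distrib_left
      by (intro sum.cong) (simp_all add: prod_\<gamma>'[simplified] \<gamma>'(2) mult_ac)
    finally show "?h \<gamma> (Suc b) \<alpha> - g \<alpha> \<gamma> = (?h \<gamma> b \<alpha> - g \<alpha> \<gamma>)
        - (\<Sum>j<q. (?h (\<gamma>' j) b \<alpha> - g \<alpha> (\<gamma>' j)) + g \<alpha> (\<gamma>' j))"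
      by simp
  qed
qed

text \<open>A power of $y_j = x_j + \alpha_j$ becomes a falling factorial of $\alpha_j - 1$ one
  factor at a time. Writing $y_j = (\alpha_j - 1 - e) + (x_j + 1 + e)$, where \<open>e\<close> is the length
  of the falling factorial reached so far, the first summand extends it by one factor, while
  the second is a constant and leaves a product of smaller total degree. The function \<open>d\<close> records how
  many plain factors remain in each coordinate. The last part of \<open>\<gamma>\<close> absorbs the lost degree,
  so that \<open>\<gamma>\<close> stays a composition of \<open>n\<close>; it therefore grows as the rank falls.\<close>
lemma powers_to_falling:
  fixes x :: "nat \<Rightarrow> 'a::comm_ring_1" and n q :: nat
  defines "C \<equiv> proper_compositions n (Suc q)"
    and "y \<equiv> \<lambda>\<alpha> j. x j + of_nat (\<alpha> ! j)"
    and "g \<equiv> \<lambda>\<alpha> \<gamma>. (\<Prod>j<q. falling (\<alpha> ! j - 1) (\<gamma> ! j - 1)) :: 'a"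
  assumes "\<gamma> \<in> C" "\<forall>j<q. d j \<le> \<gamma> ! j - 1"
  shows "(\<lambda>\<alpha>. (\<Prod>j<q. falling (\<alpha> ! j - 1) (\<gamma> ! j - 1 - d j) * y \<alpha> j ^ d j) - g \<alpha> \<gamma>)
    \<in> lower_span C (\<lambda>\<gamma>. n - \<gamma> ! q) g (n - \<gamma> ! q)"
  using assms(4,5)
proof (induction "\<Sum>j<q. d j" arbitrary: d \<gamma>)
  case 0
  then show ?case by (simp add: g_def lower_span_zero)
next
  case (Suc s)
  have fin: "finite C" by (simp add: C_def finite_proper_compositions)
  have len: "length \<gamma> = Suc q" using Suc.prems by (simp add: C_def proper_compositions_def)
  have "\<exists>j<q. d j \<noteq> 0"
    using Suc.hyps(2) by (metis lessThan_iff nat.distinct(1) sum.neutral)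
  then obtain j k where j: "j < q" "d j = Suc k" by (metis not0_implies_Suc)
  define e where "e = \<gamma> ! j - 1 - d j"
  have \<gamma>j: "\<gamma> ! j = Suc (Suc (e + k))" using Suc.prems j by (auto simp: e_def)
  \<comment> \<open>\<open>d'\<close> with \<open>\<gamma>\<close> describes the term whose falling factorial grows, \<open>d'\<close> with \<open>\<gamma>'\<close> the other.\<close>
  define d' where "d' = d(j := k)"
  define \<gamma>' where "\<gamma>' = \<gamma>[j := \<gamma> ! j - 1, q := \<gamma> ! q + 1]"
  have \<gamma>'C: "\<gamma>' \<in> C"
    using Suc.prems move_unit[of \<gamma> n "Suc q" j q] j \<gamma>j by (auto simp: \<gamma>'_def C_def)
  have \<gamma>'_nth: "\<gamma>' ! q = Suc (\<gamma> ! q)" "\<gamma>' ! j = Suc (e + k)"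
    "\<And>i. i < q \<Longrightarrow> i \<noteq> j \<Longrightarrow> \<gamma>' ! i = \<gamma> ! i"
    using len j \<gamma>j by (auto simp: \<gamma>'_def)
  have rank: "n - \<gamma>' ! q < n - \<gamma> ! q"
    using part_le[of \<gamma>' n "Suc q" q] \<gamma>'C \<gamma>'_nth(1) by (simp add: C_def)
  have s: "s = (\<Sum>i<q. d' i)"
    using Suc.hyps(2) j by (simp add: d'_def sum.remove[of "{..<q}" j])
  let ?h = "\<lambda>\<gamma> d \<alpha>. (\<Prod>j<q. falling (\<alpha> ! j - 1) (\<gamma> ! j - 1 - d j) * y \<alpha> j ^ d j)"
  let ?L = "lower_span C (\<lambda>\<gamma>. n - \<gamma> ! q) g (n - \<gamma> ! q)"
  have same: "(\<lambda>\<alpha>. ?h \<gamma> d' \<alpha> - g \<alpha> \<gamma>) \<in> ?L"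
    using Suc.prems j by (intro Suc.hyps(1)[OF s]) (auto simp: d'_def)
  have "(\<lambda>\<alpha>. ?h \<gamma>' d' \<alpha> - g \<alpha> \<gamma>') \<in> ?L"
    by (rule lower_span_mono[OF fin Suc.hyps(1)[OF s \<gamma>'C]])
      (use Suc.prems j \<gamma>'_nth rank in \<open>auto simp: d'_def\<close>)
  moreover have "(\<lambda>\<alpha>. g \<alpha> \<gamma>') \<in> ?L"
    by (rule lower_span_base) (use fin \<gamma>'C rank in auto)
  ultimately have "(\<lambda>\<alpha>. (?h \<gamma>' d' \<alpha> - g \<alpha> \<gamma>') + g \<alpha> \<gamma>') \<in> ?L"
    by (rule lower_span_add)
  then have lower: "?h \<gamma>' d' \<in> ?L" by simp
  have "(\<lambda>\<alpha>. (?h \<gamma> d' \<alpha> - g \<alpha> \<gamma>) + (x j + 1 + of_nat e) * ?h \<gamma>' d' \<alpha>) \<in> ?L"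
    by (rule lower_span_add[OF same lower_span_scale[OF lower]])
  then show ?case
  proof (rule lower_span_cong)
    fix \<alpha> assume \<alpha>: "\<alpha> \<in> C"
    then have "length \<alpha> = Suc q" "\<forall>a\<in>set \<alpha>. 1 \<le> a"
      by (auto simp: C_def proper_compositions_def)
    then have "1 \<le> \<alpha> ! j" using j by auto
    then have y: "y \<alpha> j = (of_nat (\<alpha> ! j - 1) - of_nat e) + (x j + 1 + of_nat e)"
      by (simp add: y_def of_nat_diff)
    define R where "R = (\<Prod>i\<in>{..<q} - {j}. falling (\<alpha> ! i - 1) (\<gamma> ! i - 1 - d i) * y \<alpha> i ^ d i)"
    define A where "A = falling (\<alpha> ! j - 1) e * y \<alpha> j ^ k"
    have split: "?h \<gamma> d \<alpha> = A * y \<alpha> j * R"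
      using j by (simp add: prod.remove[of "{..<q}" j] R_def A_def \<gamma>j mult_ac)
    have "?h \<gamma> d' \<alpha> = A * (of_nat (\<alpha> ! j - 1) - of_nat e) * R"
    proof -
      have "(\<Prod>i\<in>{..<q} - {j}. falling (\<alpha> ! i - 1) (\<gamma> ! i - 1 - d' i) * y \<alpha> i ^ d' i) = R"
        unfolding R_def by (intro prod.cong) (auto simp: d'_def)
      then show ?thesis
        using j by (simp add: prod.remove[of "{..<q}" j] A_def \<gamma>j d'_def falling_Suc Suc_diff_le mult_ac)
    qed
    moreover have "?h \<gamma>' d' \<alpha> = A * R"
    proof -
      have "(\<Prod>i\<in>{..<q} - {j}. falling (\<alpha> ! i - 1) (\<gamma>' ! i - 1 - d' i) * y \<alpha> i ^ d' i) = R"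
        unfolding R_def by (intro prod.cong) (auto simp: d'_def \<gamma>'_nth)
      then show ?thesis
        using j by (simp add: prod.remove[of "{..<q}" j] A_def \<gamma>'_nth d'_def mult_ac)
    qed
    ultimately show "?h \<gamma> d \<alpha> - g \<alpha> \<gamma>
        = (?h \<gamma> d' \<alpha> - g \<alpha> \<gamma>) + (x j + 1 + of_nat e) * ?h \<gamma>' d' \<alpha>"
      unfolding split by (subst y) (simp add: algebra_simps)
  qed
qed

text \<open>A falling factorial of $a$ of length greater than $a$ vanishes, so an entry is nonzero only if
  $\gamma_j \le \alpha_j$ for all $j < q$. Since both vectors have the same sum, either they
  agree or $\gamma_q$ is the larger last part.\<close>
lemma det_falling:
  assumes "distinct cs" "set cs = proper_compositions n (Suc q)"
  shows "det_table cs (\<lambda>\<alpha> \<gamma>. \<Prod>j<q. falling (\<alpha> ! j - 1) (\<gamma> ! j - 1) :: 'a::comm_ring_1)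
    = (\<Prod>\<alpha>\<in>set cs. \<Prod>j<q. of_nat (fact (\<alpha> ! j - 1)))"
proof (subst det_table_triangular[OF assms(1), where r = "\<lambda>\<alpha>. \<alpha> ! q"])
  fix \<alpha> \<gamma>
  assume mem: "\<alpha> \<in> set cs" "\<gamma> \<in> set cs"
    and nz: "(\<Prod>j<q. falling (\<alpha> ! j - 1) (\<gamma> ! j - 1) :: 'a) \<noteq> 0"
  have len: "length \<alpha> = Suc q" "length \<gamma> = Suc q" and pos: "\<forall>a\<in>set \<alpha>. 1 \<le> a"
    using mem by (auto simp: assms(2) proper_compositions_def)
  have le: "\<gamma> ! j \<le> \<alpha> ! j" if j: "j < q" for j
  proof (rule ccontr)
    assume "\<not> \<gamma> ! j \<le> \<alpha> ! j"
    moreover have "1 \<le> \<alpha> ! j" using pos len j by simp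
    ultimately have "falling (\<alpha> ! j - 1) (\<gamma> ! j - 1) = (0 :: 'a)"
      by (intro falling_eq_0) linarith
    then have "(\<Prod>j<q. falling (\<alpha> ! j - 1) (\<gamma> ! j - 1) :: 'a) = 0"
      using j by (intro prod_zero) auto
    with nz show False by simp
  qed
  have total: "(\<Sum>j<q. \<alpha> ! j) + \<alpha> ! q = (\<Sum>j<q. \<gamma> ! j) + \<gamma> ! q"
    using sum_nth_composition[of \<alpha> n "Suc q"] sum_nth_composition[of \<gamma> n "Suc q"] mem
    by (simp add: assms(2))
  show "\<alpha> = \<gamma> \<or> \<alpha> ! q < \<gamma> ! q"
  proof (cases "\<forall>j<q. \<alpha> ! j = \<gamma> ! j")
    case True
    then have "\<alpha> ! q = \<gamma> ! q" using total by simp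
    with True have "\<alpha> = \<gamma>" using len by (intro nth_equalityI) (auto simp: less_Suc_eq)
    then show ?thesis ..
  next
    case False
    then have "(\<Sum>j<q. \<gamma> ! j) < (\<Sum>j<q. \<alpha> ! j)"
      using le by (intro sum_strict_mono_ex1) (force simp: order_less_le)+
    then show ?thesis using total by simp
  qed
qed (simp add: falling_self)

text \<open>The evaluation with every factor still indexed by the compositions; it holds over any
  commutative ring, since all steps are unitriangular or pull a factor out of a row or a column.\<close>
lemma det_shifted_powers:
  fixes x :: "nat \<Rightarrow> 'a::comm_ring_1"
  assumes cs: "distinct cs" "set cs = proper_compositions n (Suc q)"
  shows "det_table cs (\<lambda>\<alpha> \<beta>. \<Prod>j<Suc q. (x j + of_nat (\<alpha> ! j)) ^ (\<beta> ! j))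
    = (\<Prod>\<alpha>\<in>set cs. \<Prod>j<Suc q. x j + of_nat (\<alpha> ! j))
      * ((\<Prod>\<alpha>\<in>set cs. \<Prod>j<q. of_nat (fact (\<alpha> ! j - 1)))
        * ((\<Sum>j<Suc q. x j) + of_nat n) ^ (\<Sum>\<alpha>\<in>set cs. \<alpha> ! q - 1))"
proof -
  define y where "y \<alpha> j = x j + of_nat (\<alpha> ! j)" for \<alpha> j
  define S where "S = (\<Sum>j<Suc q. x j) + of_nat n"
  have pos: "0 < \<beta> ! j" if "\<beta> \<in> set cs" "j < Suc q" for \<beta> j
    using that by (auto simp: cs(2) proper_compositions_def Suc_le_eq)
  have "det_table cs (\<lambda>\<alpha> \<beta>. \<Prod>j<Suc q. y \<alpha> j ^ (\<beta> ! j))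
      = det_table cs (\<lambda>\<alpha> \<beta>. (\<Prod>j<Suc q. y \<alpha> j) * (\<Prod>j<Suc q. y \<alpha> j ^ (\<beta> ! j - 1)))"
  proof (rule det_table_cong)
    fix \<alpha> \<beta> assume "\<alpha> \<in> set cs" "\<beta> \<in> set cs"
    then show "(\<Prod>j<Suc q. y \<alpha> j ^ (\<beta> ! j))
        = (\<Prod>j<Suc q. y \<alpha> j) * (\<Prod>j<Suc q. y \<alpha> j ^ (\<beta> ! j - 1))"
      using pos[of \<beta>] unfolding prod.distrib[symmetric]
      by (intro prod.cong) (auto simp: power_Suc[symmetric] simp del: power_Suc)
  qed
  also have "\<dots> = (\<Prod>\<alpha>\<in>set cs. \<Prod>j<Suc q. y \<alpha> j)
      * det_table cs (\<lambda>\<alpha> \<beta>. \<Prod>j<Suc q. y \<alpha> j ^ (\<beta> ! j - 1))"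
    by (rule det_table_scale_rows[OF cs(1)])
  also have "det_table cs (\<lambda>\<alpha> \<beta>. \<Prod>j<Suc q. y \<alpha> j ^ (\<beta> ! j - 1))
      = det_table cs (\<lambda>\<alpha> \<gamma>. (\<Prod>j<q. y \<alpha> j ^ (\<gamma> ! j - 1)) * S ^ (\<gamma> ! q - 1))"
  proof (rule det_table_unitriangular_change[OF cs(1)])
    fix \<beta> assume "\<beta> \<in> set cs"
    then show "(\<lambda>\<alpha>. (\<Prod>j<Suc q. y \<alpha> j ^ (\<beta> ! j - 1))
          - (\<Prod>j<q. y \<alpha> j ^ (\<beta> ! j - 1)) * S ^ (\<beta> ! q - 1))
        \<in> lower_span (set cs) (\<lambda>\<gamma>. \<gamma> ! q)
          (\<lambda>\<alpha> \<gamma>. (\<Prod>j<q. y \<alpha> j ^ (\<gamma> ! j - 1)) * S ^ (\<gamma> ! q - 1)) (\<beta> ! q)"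
      using eliminate_last_coordinate[of \<beta> n q "\<beta> ! q - 1" x]
      by (simp add: cs(2) y_def S_def)
  qed
  also have "\<dots> = det_table cs (\<lambda>\<alpha> \<gamma>. \<Prod>j<q. y \<alpha> j ^ (\<gamma> ! j - 1)) * (\<Prod>\<gamma>\<in>set cs. S ^ (\<gamma> ! q - 1))"
    by (rule det_table_scale_columns[OF cs(1)])
  also have "det_table cs (\<lambda>\<alpha> \<gamma>. \<Prod>j<q. y \<alpha> j ^ (\<gamma> ! j - 1))
      = det_table cs (\<lambda>\<alpha> \<gamma>. \<Prod>j<q. falling (\<alpha> ! j - 1) (\<gamma> ! j - 1))"
  proof (rule det_table_unitriangular_change[OF cs(1)])
    fix \<beta> assume "\<beta> \<in> set cs"
    then show "(\<lambda>\<alpha>. (\<Prod>j<q. y \<alpha> j ^ (\<beta> ! j - 1))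
          - (\<Prod>j<q. falling (\<alpha> ! j - 1) (\<beta> ! j - 1)))
        \<in> lower_span (set cs) (\<lambda>\<gamma>. n - \<gamma> ! q)
          (\<lambda>\<alpha> \<gamma>. \<Prod>j<q. falling (\<alpha> ! j - 1) (\<gamma> ! j - 1)) (n - \<beta> ! q)"
      using powers_to_falling[of \<beta> n q "\<lambda>j. \<beta> ! j - 1" x]
      by (simp add: cs(2) y_def falling_0)
  qed
  also have "\<dots> = (\<Prod>\<alpha>\<in>set cs. \<Prod>j<q. of_nat (fact (\<alpha> ! j - 1)))"
    by (rule det_falling[OF cs])
  finally show ?thesis
    by (simp only: y_def S_def power_sum)
qed

section \<open>The composition determinant\<close>

theorem theorem6p1:
  fixes n p :: nat and cs :: "nat list list"
  assumes "1 \<le> p" and "p \<le> n"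
    and "distinct cs" and "set cs = proper_compositions n p"
  shows "det (compositions_matrix p cs :: 'a::{idom,ring_char_0} mpoly mat) =
    ((\<Sum>j<p. Var j) + of_nat n) ^ ibinom (int n - 1) (int p)
    * (\<Prod>i = 1..n - p + 1. \<Prod>j<p. (Var j + of_nat i) ^ ibinom (int n - int i - 1) (int p - 2))
    * (\<Prod>i = 1..n - p. of_nat i ^ ((p - 1) * ibinom (int n - int i - 1) (int p - 1)))"
proof -
  let ?C = "proper_compositions n p"
  define q where "q = p - 1"
  have p: "p = Suc q" using assms(1) by (simp add: q_def)
  have linear: "(\<Prod>\<alpha>\<in>?C. \<Prod>j<p. Var j + of_nat (\<alpha> ! j) :: 'a mpoly)
      = (\<Prod>i = 1..n - p + 1. \<Prod>j<p. (Var j + of_nat i) ^ ibinom (int n - int i - 1) (int p - 2))"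
  proof -
    have "(\<Prod>\<alpha>\<in>?C. \<Prod>j<p. Var j + of_nat (\<alpha> ! j) :: 'a mpoly)
        = (\<Prod>j<p. \<Prod>\<alpha>\<in>?C. Var j + of_nat (\<alpha> ! j))"
      by (rule prod.swap)
    also have "\<dots> = (\<Prod>j<p. \<Prod>i = 1..n - p + 1.
        (Var j + of_nat i) ^ ibinom (int n - int i - 1) (int p - 2))"
      using assms(2) by (intro prod.cong refl prod_by_part) auto
    finally show ?thesis by (simp only: prod.swap[of _ _ "{..<p}"])
  qed
  have facts: "(\<Prod>\<alpha>\<in>?C. \<Prod>j<q. of_nat (fact (\<alpha> ! j - 1)) :: 'a mpoly)
      = (\<Prod>i = 1..n - p. of_nat i ^ ((p - 1) * ibinom (int n - int i - 1) (int p - 1)))"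
  proof -
    have "(\<Prod>\<alpha>\<in>?C. \<Prod>j<q. fact (\<alpha> ! j - 1)) = (\<Prod>j<q. \<Prod>\<alpha>\<in>?C. fact (\<alpha> ! j - 1) :: nat)"
      by (rule prod.swap)
    also have "\<dots> = (\<Prod>j<q. \<Prod>i = 1..n - p. i ^ ibinom (int n - int i - 1) (int p - 1))"
      using assms(2) p by (intro prod.cong refl prod_fact_part) auto
    also have "\<dots> = (\<Prod>i = 1..n - p. i ^ ((p - 1) * ibinom (int n - int i - 1) (int p - 1)))"
      by (simp add: q_def prod_power_distrib power_mult[symmetric] mult.commute)
    finally show ?thesis
      by (simp only: of_nat_prod[symmetric] of_nat_power[symmetric])
  qed
  have "det (compositions_matrix p cs :: 'a mpoly mat)
      = det_table cs (\<lambda>\<alpha> \<beta>. \<Prod>j<Suc q. (Var j + of_nat (\<alpha> ! j)) ^ (\<beta> ! j))"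
    by (simp only: compositions_matrix_def shifted_power_def det_table_def p)
  also have "\<dots> = (\<Prod>\<alpha>\<in>?C. \<Prod>j<p. Var j + of_nat (\<alpha> ! j))
      * ((\<Prod>\<alpha>\<in>?C. \<Prod>j<q. of_nat (fact (\<alpha> ! j - 1)))
        * ((\<Sum>j<p. Var j) + of_nat n) ^ (\<Sum>\<alpha>\<in>?C. \<alpha> ! q - 1))"
    using det_shifted_powers[OF assms(3) assms(4)[unfolded p], of Var]
    by (simp only: p assms(4)[unfolded p])
  also have "(\<Sum>\<alpha>\<in>?C. \<alpha> ! q - 1) = ibinom (int n - 1) (int p)"
    using assms(2) p by (intro sum_part_minus_one) auto
  finally show ?thesis
    by (simp only: linear facts mult_ac)
qed

end
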